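(* For every integer $n\ge 1$, the number $w_{011}(n)$ of weak ascent sequences of length $n$ that avoid the pattern $011$ is given by $$w_{011}(n)=\sum_{m=1}^{n}\binom{n-1+\binom{m}{2}}{n-m}.$$
   Context: For a word $u=u_1\cdots u_\ell$ of non-negative integers, $\mathrm{wasc}(u)$ denotes the number of weak ascents of $u$, i.e. the number of positions $j$ with $1\le j\le \ell-1$ and $u_j\le u_{j+1}$. A weak ascent sequence of length $n\ge 1$ is a word $w=w_1w_2\cdots w_n$ of non-negative integers with $w_1=0$ and $w_i\le \mathrm{wasc}(w_1\cdots w_{i-1})+1$ for $i=2,\dots,n$. The word $w$ contains a pattern $p=p_1\cdots p_k$ if there are indices $i_1<\cdots<i_k$ such that $w_{i_1}\cdots w_{i_k}$ is order-isomorphic to $p$ (for all $a,b$: $w_{i_a}<w_{i_b}$ iff $p_a<p_b$, and $w_{i_a}=w_{i_b}$ iff $p_a=p_b$); otherwise $w$ avoids $p$. *)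

theory Defs
  imports Main
begin

text \<open>Words are lists of natural numbers, indexed from 0: the letter \<open>u\<^sub>j\<close> of a word is \<open>u ! (j - 1)\<close>.\<close>

definition wasc :: "nat list \<Rightarrow> nat" where
  "wasc u = card {j. Suc j < length u \<and> u ! j \<le> u ! Suc j}"

text \<open>With 0-based indices, \<open>take i w\<close> is the prefix strictly before the letter \<open>w ! i\<close>.\<close>

definition weak_ascent_seq :: "nat list \<Rightarrow> bool" where
  "weak_ascent_seq w \<longleftrightarrow>
     w \<noteq> [] \<and> w ! 0 = 0 \<and>
     (\<forall>i. 1 \<le> i \<and> i < length w \<longrightarrow> w ! i \<le> wasc (take i w) + 1)"

definition contains_pattern :: "nat list \<Rightarrow> nat list \<Rightarrow> bool" where
  "contains_pattern w p \<longleftrightarrow>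
     (\<exists>f :: nat \<Rightarrow> nat.
        strict_mono_on {..<length p} f \<and>
        (\<forall>a<length p. f a < length w) \<and>
        (\<forall>a<length p. \<forall>b<length p.
           (w ! f a < w ! f b \<longleftrightarrow> p ! a < p ! b) \<and>
           (w ! f a = w ! f b \<longleftrightarrow> p ! a = p ! b)))"

abbreviation avoids_pattern :: "nat list \<Rightarrow> nat list \<Rightarrow> bool" where
  "avoids_pattern w p \<equiv> \<not> contains_pattern w p"

definition num_avoiding :: "nat list \<Rightarrow> nat \<Rightarrow> nat" where
  "num_avoiding p n = card {w. weak_ascent_seq w \<and> length w = n \<and> avoids_pattern w p}"

end

theory Submission
  imports Defs "HOL-Computational_Algebra.Formal_Power_Series"
begin

text \<open>
  A weak ascent sequence avoids 011 iff its nonzero letters are distinct. Build it letter by letter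
  and let \<open>a\<close> be the number of nonzero letters that may come next and \<open>p\<close> the number of those
  below the last letter. Appending the \<open>i\<close>-th smallest available letter keeps \<open>a\<close> if it is an
  ascent and lowers \<open>a\<close> by one otherwise, and gives the new \<open>p = i\<close> (counting from 0); appending 0
  raises \<open>a\<close> exactly if the last letter is 0. Let \<open>x\<close> mark the nonzero letters still to
  come and put \<open>q = 1 - x\<close>. If \<open>m\<close> zeros are left, the generating function of the completions
  after a zero is
  \<open>\<Sum>\<^sub>j (a - 1 choose j) q\<^bsup>-(m + j + 2 choose 2)\<^esup> \<Prod>\<^bsub>i = 1..j\<^esub> (1 - q\<^bsup>m + i\<^esup>)\<close>.
  The word 0 has \<open>a = 1\<close>, so sequences with \<open>m\<close> zeros are counted by \<open>q\<^bsup>-(m + 1 choose 2)\<^esup>\<close>.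
\<close>

section \<open>Calculus of the operator \<open>adj\<close>\<close>

text \<open>The adjoint of multiplication by \<open>1 + c y\<close>: the value of \<open>(adj c ^^ p) s\<close> at 0 is
  \<open>\<Sum>\<^sub>j (p choose j) c\<^sup>j s\<^sub>j\<close>. It lets expansions in binomial coefficients be handled without sums.\<close>

definition adj :: "'a::comm_ring_1 \<Rightarrow> (nat \<Rightarrow> 'a) \<Rightarrow> nat \<Rightarrow> 'a" where
  "adj c s j = s j + c * s (Suc j)"

lemma adj_add: "adj c (\<lambda>j. f j + g j) = (\<lambda>j. adj c f j + adj c g j)"
  by (auto simp: adj_def algebra_simps)

lemma adj_diff: "adj c (\<lambda>j. f j - g j) = (\<lambda>j. adj c f j - adj c g j)"
  by (auto simp: adj_def algebra_simps)

lemma adj_scale: "adj c (\<lambda>j. d * f j) = (\<lambda>j. d * adj c f j)"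
  by (auto simp: adj_def algebra_simps)

lemma adj_funpow_add:
  "(adj c ^^ p) (\<lambda>j. f j + g j) = (\<lambda>j. (adj c ^^ p) f j + (adj c ^^ p) g j)"
  by (induction p) (auto simp: adj_add)

lemma adj_funpow_diff:
  "(adj c ^^ p) (\<lambda>j. f j - g j) = (\<lambda>j. (adj c ^^ p) f j - (adj c ^^ p) g j)"
  by (induction p) (auto simp: adj_diff)

lemma adj_funpow_scale:
  "(adj c ^^ p) (\<lambda>j. d * f j) = (\<lambda>j. d * (adj c ^^ p) f j)"
  by (induction p) (auto simp: adj_scale)

text \<open>The weight \<open>q ^ j\<close> conjugates \<open>adj 1\<close> into
  \<open>adj q\<close>. At index 0 it is 1, so there powers of \<open>adj q\<close> can be traded
  for powers of \<open>adj 1\<close>.\<close>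

lemma adj_funpow_geometric:
  "(adj 1 ^^ p) (\<lambda>j. q ^ j * s j) = (\<lambda>j. q ^ j * (adj q ^^ p) s j)"
proof (induction p)
  case (Suc p)
  have "adj 1 (\<lambda>j. q ^ j * f j) = (\<lambda>j. q ^ j * adj q f j)" for f :: "nat \<Rightarrow> 'a"
    by (auto simp: adj_def algebra_simps)
  then show ?case
    using Suc by simp
qed simp

text \<open>The shift is \<open>adj 1\<close> minus the identity, so it acts as a forward difference
  in \<open>p\<close>.\<close>

lemma adj_funpow_shift:
  "(adj 1 ^^ p) (\<lambda>j. s (Suc j)) = (\<lambda>j. (adj 1 ^^ Suc p) s j - (adj 1 ^^ p) s j)"
proof -
  have "(\<lambda>j. s (Suc j)) = (\<lambda>j. adj 1 s j - s j)"
    by (auto simp: adj_def)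
  then show ?thesis
    by (simp add: adj_funpow_diff funpow_swap1)
qed

section \<open>The coefficient sequences \<open>tau\<close> and \<open>sigma\<close>\<close>

abbreviation q :: "rat fps" where "q \<equiv> 1 - fps_X"

text \<open>The factor of the binomial in the formula above, with \<open>M = m + 1\<close>.\<close>

definition tau :: "nat \<Rightarrow> nat \<Rightarrow> rat fps" where
  "tau M j = inverse q ^ (Suc (M + j) choose 2) * (\<Prod>i<j. 1 - q ^ (M + i))"

text \<open>Chosen to make \<open>fromzero_rec\<close> hold: the forward difference of
  \<open>mixed m b 0\<close> in \<open>b\<close> expands with the shift of
  \<open>sigma m\<close>.\<close>

definition sigma :: "nat \<Rightarrow> nat \<Rightarrow> rat fps" where
  "sigma m j = (case j of 0 \<Rightarrow> 0 | Suc i \<Rightarrow> tau (Suc m) i - tau m (Suc i))"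

lemma q_inverse: "q * inverse q = 1"
  by (rule inverse_mult_eq_1') simp

lemma q_inverse_power: "q ^ k * inverse q ^ (k + l) = inverse q ^ l"
  by (simp add: power_add mult.assoc[symmetric] power_mult_distrib[symmetric] q_inverse)

text \<open>Both \<open>tau\<close> terms carry the same power of \<open>inverse q\<close>, and
  their products differ by the factor \<open>1 - q ^ m\<close>; the difference leaves
  \<open>q ^ m\<close>.\<close>

lemma sigma_Suc:
  "sigma m (Suc j) = q ^ m * inverse q ^ (Suc (Suc (m + j)) choose 2) * (\<Prod>i<j. 1 - q ^ (Suc m + i))"
proof -
  define P where "P = (\<Prod>i<j. 1 - q ^ (Suc m + i))"
  have "(\<Prod>i<Suc j. 1 - q ^ (m + i)) = (1 - q ^ m) * P"
    unfolding P_def by (subst prod.lessThan_Suc_shift) simp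
  then have "sigma m (Suc j) =
      inverse q ^ (Suc (Suc (m + j)) choose 2) * P - inverse q ^ (Suc (Suc (m + j)) choose 2) * ((1 - q ^ m) * P)"
    by (simp add: sigma_def tau_def P_def del: prod.lessThan_Suc)
  then show ?thesis
    unfolding P_def [symmetric] by (simp add: algebra_simps)
qed

text \<open>The left side is \<open>adj 1\<close> of the weighted \<open>sigma\<close>, as
  \<open>mixed_diagonal\<close> needs. For \<open>j > 0\<close> both sides reduce to
  \<open>I * P\<close>.\<close>

lemma sigma_tau: "q ^ j * sigma m j + q ^ Suc j * sigma m (Suc j) = sigma m j + tau m j"
proof -
  \<comment> \<open>The extra \<open>Suc (m + j)\<close> factors \<open>inverse q\<close> cancel
    \<open>q ^ Suc j\<close> and the \<open>q ^ m\<close> of \<open>sigma_Suc\<close>.\<close>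
  have choose: "Suc (Suc (m + j)) choose 2 = Suc (m + j) + (Suc (m + j) choose 2)"
    by (simp add: numeral_2_eq_2)
  have "q ^ Suc j * sigma m (Suc j)
      = q ^ Suc (m + j) * inverse q ^ (Suc (m + j) + (Suc (m + j) choose 2)) * (\<Prod>i<j. 1 - q ^ (Suc m + i))"
    unfolding sigma_Suc choose by (simp add: power_add mult_ac)
  also have "\<dots> = inverse q ^ (Suc (m + j) choose 2) * (\<Prod>i<j. 1 - q ^ (Suc m + i))"
    by (simp only: q_inverse_power)
  finally have *: "q ^ Suc j * sigma m (Suc j) =
    inverse q ^ (Suc (m + j) choose 2) * (\<Prod>i<j. 1 - q ^ (Suc m + i))" .
  show ?thesis
  proof (cases j)
    case 0
    then show ?thesis using * by (simp add: sigma_def tau_def)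
  next
    case (Suc i)
    define P where "P = (\<Prod>l<i. 1 - q ^ (Suc m + l))"
    define I where "I = inverse q ^ (Suc (m + j) choose 2)"
    have 1: "(\<Prod>l<j. 1 - q ^ (m + l)) = (1 - q ^ m) * P"
      unfolding Suc P_def by (subst prod.lessThan_Suc_shift) simp
    have 2: "(\<Prod>l<j. 1 - q ^ (Suc m + l)) = P * (1 - q ^ (m + j))"
      by (simp add: Suc P_def)
    have 3: "sigma m j = q ^ m * I * P"
      unfolding Suc sigma_Suc by (simp add: I_def P_def Suc)
    have "q ^ j * sigma m j + I * (P * (1 - q ^ (m + j))) = sigma m j + I * ((1 - q ^ m) * P)"
      unfolding 3 by (simp add: algebra_simps power_add)
    then show ?thesis
      unfolding * 2 tau_def 1 I_def by simp
  qed
qed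

section \<open>Generating functions and their recurrences\<close>

text \<open>Completions with \<open>M - 1\<close> further zeros of a word that ends in 0 and has \<open>b + 1\<close> available
  letters; \<open>fromzero 0\<close> is 1, for the word that is already finished.\<close>

definition fromzero :: "nat \<Rightarrow> nat \<Rightarrow> rat fps" where
  "fromzero M b = (adj 1 ^^ b) (tau M) 0"

text \<open>An antiderivative of \<open>frompos\<close> in both arguments (\<open>frompos_def\<close> and \<open>mixed_diff\<close>), so that
  the sums in the recurrences telescope.\<close>

definition mixed :: "nat \<Rightarrow> nat \<Rightarrow> nat \<Rightarrow> rat fps" where
  "mixed m a p = (adj q ^^ p) ((adj 1 ^^ (a - p)) (sigma m)) 0"

text \<open>Completions with \<open>m\<close> further zeros of a word that ends in a nonzero letter and has \<open>b + 1\<close>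
  available letters, \<open>p\<close> of them below the last letter.\<close>

definition frompos :: "nat \<Rightarrow> nat \<Rightarrow> nat \<Rightarrow> rat fps" where
  "frompos m b p = mixed m (Suc b) p - mixed m b p"

text \<open>Since \<open>fps_X\<close> is \<open>1 - q\<close>, it turns the shift
  \<open>adj 1 f - f\<close> into \<open>adj 1 f - adj q f\<close>: a difference in the first
  argument becomes one in the second.\<close>

lemma mixed_diff:
  assumes "p \<le> b"
  shows "fps_X * frompos m b p = mixed m (Suc b) p - mixed m (Suc b) (Suc p)"
proof -
  define f where "f = (adj 1 ^^ (b - p)) (sigma m)"
  have 1: "(adj 1 ^^ (Suc b - p)) (sigma m) = adj 1 f"
    using assms by (simp add: f_def Suc_diff_le)
  have "fps_X * frompos m b p = (adj q ^^ p) (\<lambda>j. fps_X * (adj 1 f j - f j)) 0"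
    unfolding frompos_def mixed_def 1 adj_funpow_scale adj_funpow_diff by (simp add: f_def)
  also have "(\<lambda>j. fps_X * (adj 1 f j - f j)) = (\<lambda>j. adj 1 f j - adj q f j)"
    by (auto simp: adj_def algebra_simps)
  also have "(adj q ^^ p) \<dots> 0 = mixed m (Suc b) p - mixed m (Suc b) (Suc p)"
    unfolding adj_funpow_diff mixed_def 1 by (simp add: f_def funpow_swap1)
  finally show ?thesis .
qed

text \<open>On the diagonal only \<open>adj q\<close> remains. It is traded for
  \<open>adj 1\<close>, one application of which is \<open>sigma_tau\<close>. This is the end term
  of the telescoping sums.\<close>

lemma mixed_diagonal: "mixed m (Suc b) (Suc b) = fromzero m b + mixed m b 0"
proof -
  have "mixed m (Suc b) (Suc b) = (adj 1 ^^ Suc b) (\<lambda>j. q ^ j * sigma m j) 0"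
    unfolding adj_funpow_geometric by (simp add: mixed_def)
  also have "\<dots> = (adj 1 ^^ b) (adj 1 (\<lambda>j. q ^ j * sigma m j)) 0"
    by (simp add: funpow_swap1)
  also have "adj 1 (\<lambda>j. q ^ j * sigma m j) = (\<lambda>j. sigma m j + tau m j)"
    using sigma_tau by (simp add: adj_def fun_eq_iff)
  finally show ?thesis
    by (simp add: adj_funpow_add mixed_def fromzero_def)
qed

lemma sum_frompos:
  assumes "p \<le> c" "c \<le> Suc b"
  shows "fps_X * (\<Sum>i=p..<c. frompos m b i) = mixed m (Suc b) p - mixed m (Suc b) c"
proof -
  have "fps_X * (\<Sum>i=p..<c. frompos m b i) = (\<Sum>i=p..<c. mixed m (Suc b) i - mixed m (Suc b) (Suc i))"
    unfolding sum_distrib_left using assms by (intro sum.cong) (auto simp: mixed_diff)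
  also have "\<dots> = mixed m (Suc b) p - mixed m (Suc b) c"
    using sum_Suc_diff'[of p c "\<lambda>i. - mixed m (Suc b) i"] assms by simp
  finally show ?thesis .
qed

text \<open>After a zero, another zero frees a letter, and every nonzero letter is an ascent and
  keeps their number.\<close>

lemma fromzero_rec:
  "fromzero (Suc m) b = fromzero m (Suc b) + fps_X * (\<Sum>p<Suc b. frompos m b p)"
proof -
  have "mixed m (Suc b) 0 - mixed m b 0 = (adj 1 ^^ b) (\<lambda>j. sigma m (Suc j)) 0"
    unfolding adj_funpow_shift by (simp add: mixed_def)
  also have "\<dots> = (adj 1 ^^ b) (\<lambda>j. tau (Suc m) j - tau m (Suc j)) 0"
    by (simp add: sigma_def)
  also have "\<dots> = fromzero (Suc m) b - (fromzero m (Suc b) - fromzero m b)"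
    unfolding adj_funpow_diff adj_funpow_shift by (simp add: fromzero_def)
  finally have *: "mixed m (Suc b) 0 - mixed m b 0 = fromzero (Suc m) b - (fromzero m (Suc b) - fromzero m b)" .
  have "fps_X * (\<Sum>p<Suc b. frompos m b p) = (mixed m (Suc b) 0 - mixed m b 0) - fromzero m b"
    using sum_frompos[of 0 "Suc b" b m] mixed_diagonal[of m b]
    by (simp add: atLeast0LessThan del: sum.lessThan_Suc)
  then show ?thesis
    unfolding * by simp
qed

text \<open>After a nonzero letter, a zero keeps the number of available letters, the
  \<open>p\<close> smaller letters lower it, and the others keep it.\<close>

lemma frompos_rec:
  assumes "p \<le> b"
  shows "frompos m b p = fromzero m b + fps_X * ((\<Sum>i<p. frompos m (b - 1) i) + (\<Sum>i=p..<Suc b. frompos m b i))"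
proof -
  have "fps_X * (\<Sum>i<p. frompos m (b - 1) i) = mixed m b 0 - mixed m b p"
  \<comment> \<open>For \<open>b = 0\<close> the truncated \<open>b - 1\<close> is harmless:
    \<open>p = 0\<close> and the sum is empty.\<close>
  proof (cases b)
    case (Suc c)
    then show ?thesis
      using sum_frompos[of 0 p c m] assms by (simp add: atLeast0LessThan)
  qed (use assms in simp)
  then show ?thesis
    using sum_frompos[of p "Suc b" b m] mixed_diagonal[of m b] assms
    by (simp only: distrib_left) (simp add: frompos_def)
qed

lemma fromzero_0: "fromzero 0 b = 1"
proof -
  \<comment> \<open>For \<open>j > 0\<close> the product contains the factor
    \<open>1 - q ^ 0 = 0\<close>.\<close>
  have "tau 0 = (\<lambda>j. if j = 0 then 1 else 0)"
    by (force simp: tau_def fun_eq_iff numeral_2_eq_2)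
  moreover have "(adj 1 ^^ b) (\<lambda>j. if j = 0 then 1 else 0) = (\<lambda>j. if j = 0 then 1 else (0::rat fps))"
    by (induction b) (auto simp: adj_def)
  ultimately show ?thesis
    by (simp add: fromzero_def)
qed

section \<open>Extraction of coefficients\<close>

lemma fps_nth_inverse_power:
  assumes "N > 0"
  shows "fps_nth (inverse q ^ N) k = of_nat ((N + k - 1) choose k)"
proof -
  have "inverse q ^ N = inverse ((1 - fps_const 1 * fps_X) ^ N)"
    by (simp add: fps_inverse_power)
  then show ?thesis
    unfolding one_minus_const_fps_X_neg_power'[OF assms] by simp
qed

lemma fps_nth_fromzero:
  assumes "m > 0"
  shows "fps_nth (fromzero m 0) k = of_nat ((m + k - 1 + (m choose 2)) choose k)"
proof -
  have "Suc m choose 2 = m + (m choose 2)"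
    by (simp add: numeral_2_eq_2)
  with assms show ?thesis
    by (simp add: fromzero_def tau_def fps_nth_inverse_power add_ac)
qed

section \<open>Avoiders, letter by letter\<close>

definition avoider :: "nat list \<Rightarrow> bool" where
  "avoider w \<longleftrightarrow> weak_ascent_seq w \<and> avoids_pattern w [0, 1, 1]"

text \<open>The leading zero serves as the 0 of the pattern for any repeated nonzero letter.\<close>

lemma contains_011_iff:
  assumes "w \<noteq> []" "w ! 0 = 0"
  shows "contains_pattern w [0, 1, 1] \<longleftrightarrow> (\<exists>i j. i < j \<and> j < length w \<and> w ! i = w ! j \<and> w ! i \<noteq> 0)"
proof
  assume "contains_pattern w [0, 1, 1]"
  then obtain f where f: "strict_mono_on {..<3} f" "\<forall>a<3. f a < length w"
    "\<forall>a<3. \<forall>b<3. (w ! f a < w ! f b \<longleftrightarrow> [0, 1, 1::nat] ! a < [0, 1, 1] ! b) \<and>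
           (w ! f a = w ! f b \<longleftrightarrow> [0, 1, 1::nat] ! a = [0, 1, 1] ! b)"
    by (auto simp: contains_pattern_def numeral_3_eq_3)
  have "f 1 < f 2"
    using f(1) by (rule strict_mono_onD) auto
  moreover have "w ! f 1 = w ! f 2" "w ! f 0 < w ! f 1" "f 2 < length w"
    using f(2,3) by auto
  ultimately show "\<exists>i j. i < j \<and> j < length w \<and> w ! i = w ! j \<and> w ! i \<noteq> 0"
    by (metis not_less_zero)
next
  assume "\<exists>i j. i < j \<and> j < length w \<and> w ! i = w ! j \<and> w ! i \<noteq> 0"
  then obtain i j where ij: "i < j" "j < length w" "w ! i = w ! j" "w ! i \<noteq> 0"
    by blast
  then have "0 < i"
    using assms by (cases i) auto
  define f where "f = (\<lambda>a::nat. if a = 0 then 0 else if a = 1 then i else j)"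
  have all: "(\<forall>a<length [0, 1, 1::nat]. P a) \<longleftrightarrow> P 0 \<and> P 1 \<and> P 2" for P
    by (auto simp: less_Suc_eq numeral_2_eq_2)
  have "strict_mono_on {..<length [0, 1, 1::nat]} f"
    using ij \<open>0 < i\<close> by (auto simp: strict_mono_on_def f_def)
  then show "contains_pattern w [0, 1, 1]"
    unfolding contains_pattern_def all using ij assms \<open>0 < i\<close>
    by (intro exI[of _ f]) (auto simp: f_def)
qed

lemma wasc_snoc:
  assumes "u \<noteq> []"
  shows "wasc (u @ [x]) = wasc u + (if last u \<le> x then 1 else 0)"
proof -
  let ?A = "{j. Suc j < length u \<and> u ! j \<le> u ! Suc j}"
  have "finite ?A"
    by (rule finite_subset[of _ "{..<length u}"]) auto
  moreover have "{j. Suc j < length (u @ [x]) \<and> (u @ [x]) ! j \<le> (u @ [x]) ! Suc j}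
      = (if last u \<le> x then insert (length u - 1) ?A else ?A)"
  proof -
    obtain l where l: "length u = Suc l"
      using assms by (cases "length u") auto
    moreover from l have "last u = u ! l"
      using assms by (simp add: last_conv_nth)
    ultimately show ?thesis
      by (auto simp: nth_append less_Suc_eq)
  qed
  ultimately show ?thesis
    using assms by (simp add: wasc_def)
qed

lemma weak_ascent_seq_snoc:
  assumes "u \<noteq> []"
  shows "weak_ascent_seq (u @ [x]) \<longleftrightarrow> weak_ascent_seq u \<and> x \<le> wasc u + 1"
proof -
  let ?P = "\<lambda>w i. w ! i \<le> wasc (take i w) + 1"
  have "(\<forall>i. 1 \<le> i \<and> i < length (u @ [x]) \<longrightarrow> ?P (u @ [x]) i)
    \<longleftrightarrow> (\<forall>i. 1 \<le> i \<and> i < length u \<longrightarrow> ?P (u @ [x]) i) \<and> (1 \<le> length u \<longrightarrow> ?P (u @ [x]) (length u))"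
    unfolding length_append_singleton less_Suc_eq by blast
  also have "(\<forall>i. 1 \<le> i \<and> i < length u \<longrightarrow> ?P (u @ [x]) i) \<longleftrightarrow> (\<forall>i. 1 \<le> i \<and> i < length u \<longrightarrow> ?P u i)"
    by (intro all_cong1 imp_cong) (auto simp: nth_append)
  finally show ?thesis
    using assms unfolding weak_ascent_seq_def by (simp add: nth_append Suc_le_eq)
qed

lemma avoider_snoc:
  assumes "u \<noteq> []"
  shows "avoider (u @ [x]) \<longleftrightarrow> avoider u \<and> x \<le> wasc u + 1 \<and> (x = 0 \<or> x \<notin> set u)"
proof -
  have *: "contains_pattern (u @ [x]) [0, 1, 1] \<longleftrightarrow> contains_pattern u [0, 1, 1] \<or> (x \<noteq> 0 \<and> x \<in> set u)"
    if "u ! 0 = 0"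
  proof -
    let ?P = "\<lambda>w i j. w ! i = w ! j \<and> w ! i \<noteq> (0::nat)"
    have "(\<exists>i j. i < j \<and> j < length (u @ [x]) \<and> ?P (u @ [x]) i j)
      \<longleftrightarrow> (\<exists>i j. i < j \<and> j < length u \<and> ?P (u @ [x]) i j) \<or> (\<exists>i<length u. ?P (u @ [x]) i (length u))"
      unfolding length_append_singleton less_Suc_eq by blast
    also have "(\<exists>i j. i < j \<and> j < length u \<and> ?P (u @ [x]) i j) \<longleftrightarrow> (\<exists>i j. i < j \<and> j < length u \<and> ?P u i j)"
      by (intro ex_cong1 conj_cong) (auto simp: nth_append)
    also have "(\<exists>i<length u. ?P (u @ [x]) i (length u)) \<longleftrightarrow> x \<noteq> 0 \<and> x \<in> set u"
      by (auto simp: nth_append in_set_conv_nth)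
    finally show ?thesis
      using that assms contains_011_iff[of u] contains_011_iff[of "u @ [x]"] by (simp add: nth_append)
  qed
  show ?thesis
    unfolding avoider_def weak_ascent_seq_snoc[OF assms]
    using * by (auto simp: weak_ascent_seq_def)
qed

lemma avoider_append: "avoider (u @ v) \<Longrightarrow> u \<noteq> [] \<Longrightarrow> avoider u"
proof (induction v rule: rev_induct)
  case (snoc x v)
  then show ?case
    using avoider_snoc[of "u @ v" x] by simp
qed simp

lemma avoider_nonempty: "avoider u \<Longrightarrow> u \<noteq> []"
  by (simp add: avoider_def weak_ascent_seq_def)

lemma avoider_single: "avoider [x] \<longleftrightarrow> x = 0"
proof (cases "x = 0")
  case True
  then show ?thesis
    using contains_011_iff[of "[x]"] by (simp add: avoider_def weak_ascent_seq_def)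
qed (simp add: avoider_def weak_ascent_seq_def)

lemma avoider_induct [consumes 1, case_names single snoc]:
  assumes "avoider w" "P [0]"
    and "\<And>u x. u \<noteq> [] \<Longrightarrow> avoider u \<Longrightarrow> avoider (u @ [x]) \<Longrightarrow> P u \<Longrightarrow> P (u @ [x])"
  shows "P w"
  using assms(1)
proof (induction w rule: rev_induct)
  case (snoc x u)
  then show ?case
    using assms(2,3) avoider_append[of u "[x]"] by (cases "u = []") (auto simp: avoider_single)
qed (auto dest: avoider_nonempty)

lemma avoider_le_wasc:
  assumes "avoider u" "x \<in> set u"
  shows "x \<le> wasc u + 1"
  using assms
proof (induction u arbitrary: x rule: avoider_induct)
  case (snoc u y)
  then have "y \<le> wasc u + 1"
    by (simp add: avoider_snoc)
  with snoc show ?case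
    by (fastforce simp: wasc_snoc)
qed simp

section \<open>Available letters and their ranks\<close>

definition avail :: "nat list \<Rightarrow> nat set" where
  "avail u = {1..wasc u + 1} - set u"

definition below :: "nat list \<Rightarrow> nat \<Rightarrow> nat" where
  "below u x = card {y \<in> avail u. y < x}"

lemma finite_avail [simp]: "finite (avail u)"
  by (simp add: avail_def)

lemma avoider_snoc_iff_avail:
  assumes "avoider u"
  shows "avoider (u @ [x]) \<longleftrightarrow> x = 0 \<or> x \<in> avail u"
  using assms avoider_nonempty[OF assms] by (auto simp: avoider_snoc avail_def)

lemma avail_snoc:
  assumes "avoider u" "x \<le> wasc u + 1"
  shows "avail (u @ [x]) =
    (if last u \<le> x then insert (wasc u + 2) (avail u - {x}) else avail u - {x})"
proof -
  have "wasc u + 2 \<notin> set u"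
    using avoider_le_wasc[OF assms(1), of "wasc u + 2"] by auto
  moreover have "{1..wasc u + 2} = insert (wasc u + 2) {1..wasc u + 1}"
    by auto
  ultimately show ?thesis
    using assms avoider_nonempty[OF assms(1)] by (auto simp: avail_def wasc_snoc)
qed

lemma wasc_single: "wasc [x] = 0"
  by (simp add: wasc_def)

lemma avail_single: "avail [0] = {1}"
  by (auto simp: avail_def wasc_single)

text \<open>An ascent admits a new largest letter; after a descent the old witness survives.\<close>

lemma avail_gt_last:
  assumes "avoider u"
  shows "\<exists>y\<in>avail u. last u < y"
  using assms
proof (induction rule: avoider_induct)
  case (snoc u x)
  from snoc obtain y where y: "y \<in> avail u" "last u < y"
    by blast
  have "x \<le> wasc u + 1"
    using snoc by (simp add: avoider_snoc)
  with y snoc show ?case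
    by (cases "last u \<le> x") (auto simp: avail_snoc intro!: bexI[of _ y])
qed (simp add: avail_single)

lemma below_last_less:
  assumes "avoider u"
  shows "below u (last u) < card (avail u)"
proof -
  have "{y \<in> avail u. y < last u} \<subset> avail u"
    using avail_gt_last[OF assms] less_asym by blast
  then show ?thesis
    unfolding below_def by (intro psubset_card_mono) simp_all
qed

lemma card_avail_snoc_zero:
  assumes "avoider u"
  shows "card (avail (u @ [0])) = (if last u = 0 then Suc (card (avail u)) else card (avail u))"
proof -
  have "0 \<notin> avail u" "wasc u + 2 \<notin> avail u"
    by (auto simp: avail_def)
  then show ?thesis
    using assms by (simp add: avail_snoc)
qed

lemma card_avail_snoc:
  assumes "avoider u" "x \<in> avail u"
  shows "card (avail (u @ [x])) = (if last u \<le> x then card (avail u) else card (avail u) - 1)"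
proof -
  have "x \<le> wasc u + 1" "wasc u + 2 \<notin> avail u"
    using assms by (auto simp: avail_def)
  moreover have "card (avail u) > 0"
    using assms by (auto simp: card_gt_0_iff)
  ultimately show ?thesis
    using assms by (simp add: avail_snoc)
qed

text \<open>Appending \<open>x\<close> removes \<open>x\<close> and may add a letter above
  \<open>x\<close>; nothing below changes.\<close>

lemma below_snoc:
  assumes "avoider u" "x \<in> avail u"
  shows "below (u @ [x]) x = below u x"
proof -
  have "x \<le> wasc u + 1"
    using assms by (auto simp: avail_def)
  then have "{y \<in> avail (u @ [x]). y < x} = {y \<in> avail u. y < x}"
    using assms by (auto simp: avail_snoc)
  then show ?thesis
    by (simp add: below_def)
qed

text \<open>The rank maps \<open>A\<close> bijectively onto \<open>{..<card A}\<close>; a new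
  maximum takes the last rank.\<close>

lemma sum_rank:
  fixes A :: "'a::linorder set"
  assumes "finite A"
  shows "(\<Sum>x\<in>A. f (card {y \<in> A. y < x})) = (\<Sum>i<card A. f i)"
  using assms
proof (induction A rule: finite_linorder_max_induct)
  case (insert b A)
  have "{y \<in> insert b A. y < b} = A"
    using insert by auto
  moreover have "{y \<in> insert b A. y < x} = {y \<in> A. y < x}" if "x \<in> A" for x
    using insert that by auto
  moreover have "b \<notin> A"
    using insert by auto
  ultimately show ?case
    using insert by (simp add: add.commute)
qed simp

lemma sum_rank_split:
  fixes A :: "'a::linorder set" and f :: "nat \<Rightarrow> 'b::ab_group_add"
  assumes "finite A"
  shows "(\<Sum>x\<in>A. if x < l then g (card {y \<in> A. y < x}) else f (card {y \<in> A. y < x}))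
    = (\<Sum>i<card {y \<in> A. y < l}. g i) + (\<Sum>i=card {y \<in> A. y < l}..<card A. f i)"
proof -
  let ?B = "{y \<in> A. y < l}"
  have sub: "(\<Sum>x\<in>?B. h (card {y \<in> A. y < x})) = (\<Sum>i<card ?B. h i)" for h :: "nat \<Rightarrow> 'b"
  proof -
    have "{y \<in> ?B. y < x} = {y \<in> A. y < x}" if "x \<in> ?B" for x
      using that by auto
    then show ?thesis
      using sum_rank[of ?B h] assms by simp
  qed
  have "(\<Sum>x\<in>A. f (card {y \<in> A. y < x}))
      = (\<Sum>x\<in>?B. f (card {y \<in> A. y < x})) + (\<Sum>x\<in>A - ?B. f (card {y \<in> A. y < x}))"
    using assms by (subst sum.subset_diff[of ?B]) (auto simp: add.commute)
  moreover have "(\<Sum>i<card A. f i) = (\<Sum>i<card ?B. f i) + (\<Sum>i=card ?B..<card A. f i)"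
  proof -
    have "card ?B \<le> card A"
      using assms by (intro card_mono) auto
    then show ?thesis
      using sum.atLeastLessThan_concat[of 0 "card ?B" "card A" f] by (simp add: atLeast0LessThan)
  qed
  ultimately have "(\<Sum>x\<in>A - ?B. f (card {y \<in> A. y < x})) = (\<Sum>i=card ?B..<card A. f i)"
    using sub[of f] sum_rank[OF assms, of f] by simp
  moreover have "A - ?B = {x \<in> A. \<not> x < l}"
    by auto
  ultimately show ?thesis
    using sub[of g] assms by (simp add: sum.If_cases Int_def)
qed

section \<open>Counting completions by their first letter\<close>

text \<open>\<open>Suc m\<close> and \<open>- 1\<close> match the index conventions of
  \<open>fromzero\<close> and \<open>frompos\<close>.\<close>

definition completion_gf :: "nat list \<Rightarrow> nat \<Rightarrow> rat fps" where
  "completion_gf u m =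
    (if last u = 0 then fromzero (Suc m) (card (avail u) - 1)
     else frompos m (card (avail u) - 1) (below u (last u)))"

lemma completion_gf_rec:
  assumes "avoider u"
  shows "completion_gf u m =
    fromzero m (card (avail (u @ [0])) - 1) + fps_X * (\<Sum>x\<in>avail u. completion_gf (u @ [x]) m)"
proof -
  obtain b where b: "card (avail u) = Suc b"
    using below_last_less[OF assms] by (cases "card (avail u)") auto
  have "last u \<notin> avail u"
    using avoider_nonempty[OF assms] by (simp add: avail_def)
  then have "completion_gf (u @ [x]) m =
      (if x < last u then frompos m (b - 1) (card {y \<in> avail u. y < x})
       else frompos m b (card {y \<in> avail u. y < x}))" if "x \<in> avail u" for x
  proof -
    have "x \<noteq> 0" "x \<noteq> last u"
      using that \<open>last u \<notin> avail u\<close> by (auto simp: avail_def)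
    then show ?thesis
      using that assms b by (simp add: completion_gf_def card_avail_snoc below_snoc) (simp add: below_def)
  qed
  then have "(\<Sum>x\<in>avail u. completion_gf (u @ [x]) m) =
      (\<Sum>i<below u (last u). frompos m (b - 1) i) + (\<Sum>i=below u (last u)..<Suc b. frompos m b i)"
    using sum_rank_split[of "avail u" "last u" "frompos m (b - 1)" "frompos m b"] b
    by (simp add: below_def)
  moreover have "below u (last u) \<le> b"
    using below_last_less[OF assms] b by simp
  \<comment> \<open>After a zero the sum over smaller letters is empty, so both recurrences take one
    form.\<close>
  moreover have "below u 0 = 0"
    by (simp add: below_def)
  ultimately show ?thesis
    using assms b fromzero_rec[of m b] frompos_rec[of "below u (last u)" b m]
    by (auto simp: completion_gf_def card_avail_snoc_zero atLeast0LessThan)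
qed

definition completions :: "nat list \<Rightarrow> nat \<Rightarrow> nat \<Rightarrow> nat list set" where
  "completions u m k = {v. avoider (u @ v) \<and> count_list v 0 = m \<and> length v = m + k}"

lemma completions_split:
  assumes "avoider u" "m + k > 0"
  shows "completions u m k =
    (if m = 0 then {} else (#) 0 ` completions (u @ [0]) (m - 1) k) \<union>
    (if k = 0 then {} else (\<Union>x\<in>avail u. (#) x ` completions (u @ [x]) m (k - 1)))" (is "?L = ?R")
proof (intro set_eqI iffI)
  fix v assume v: "v \<in> ?L"
  then obtain x v' where [simp]: "v = x # v'"
    using assms by (cases v) (auto simp: completions_def)
  have "avoider (u @ [x])"
    using v avoider_append[of "u @ [x]" v'] by (simp add: completions_def)
  then have x: "x = 0 \<or> x \<in> avail u"
    using assms by (simp add: avoider_snoc_iff_avail)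
  \<comment> \<open>With a nonzero first letter this forces \<open>k > 0\<close>.\<close>
  have "count_list v' 0 \<le> length v'"
    by (rule count_le_length)
  with v x show "v \<in> ?R"
    by (auto simp: completions_def avail_def image_iff split: if_splits)
next
  fix v assume "v \<in> ?R"
  then show "v \<in> ?L"
    by (auto simp: completions_def avail_def split: if_splits)
qed

lemma card_completions:
  assumes "avoider u"
  shows "finite (completions u m k) \<and> of_nat (card (completions u m k)) = fps_nth (completion_gf u m) k"
  using assms
proof (induction "m + k" arbitrary: u m k)
  case 0
  then have "completions u m k = {[]}"
    by (auto simp: completions_def)
  \<comment> \<open>The \<open>fps_X\<close> term has no constant coefficient, and
    \<open>fromzero 0\<close> is 1.\<close>
  then show ?case
    using 0 by (simp add: completion_gf_rec[OF 0(2)] fromzero_0)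
next
  case (Suc n)
  let ?Z = "if m = 0 then {} else (#) 0 ` completions (u @ [0]) (m - 1) k"
  let ?P = "if k = 0 then {} else (\<Union>x\<in>avail u. (#) x ` completions (u @ [x]) m (k - 1))"
  have split: "completions u m k = ?Z \<union> ?P"
    using Suc by (intro completions_split) auto
  have Z: "finite ?Z \<and> of_nat (card ?Z) = fps_nth (fromzero m (card (avail (u @ [0])) - 1)) k"
  proof (cases m)
    case 0
    \<comment> \<open>Here \<open>k > 0\<close>, so the constant series 1 contributes 0.\<close>
    then show ?thesis using Suc by (simp add: fromzero_0)
  next
    case (Suc m')
    have "avoider (u @ [0])"
      using \<open>avoider u\<close> by (simp add: avoider_snoc_iff_avail)
    then show ?thesis
      using Suc.hyps(1)[of m' k "u @ [0]"] Suc \<open>Suc n = m + k\<close>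
      by (simp add: completion_gf_def card_image)
  qed
  have P: "finite ?P \<and> of_nat (card ?P) = fps_nth (fps_X * (\<Sum>x\<in>avail u. completion_gf (u @ [x]) m)) k"
  proof (cases k)
    case (Suc k')
    have IH: "finite (completions (u @ [x]) m k') \<and>
        of_nat (card (completions (u @ [x]) m k')) = fps_nth (completion_gf (u @ [x]) m) k'"
      if "x \<in> avail u" for x
      using that Suc.hyps(1)[of m k' "u @ [x]"] Suc \<open>Suc n = m + k\<close> \<open>avoider u\<close>
      by (simp add: avoider_snoc_iff_avail)
    then have "card ?P = (\<Sum>x\<in>avail u. card ((#) x ` completions (u @ [x]) m k'))"
      using Suc by (simp, intro card_UN_disjoint) auto
    then show ?thesis
      using IH Suc by (simp add: card_image fps_sum_nth)
  qed simp
  have "?Z \<inter> ?P = {}"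
    by (auto simp: avail_def)
  then show ?case
    unfolding split completion_gf_rec[OF \<open>avoider u\<close>] using Z P by (simp add: card_Un_disjoint)
qed

section \<open>Summation over the number \<open>m\<close> of zeros, the leading one included\<close>

lemma avoider_eq_completions:
  assumes "n \<ge> 1"
  shows "{w. avoider w \<and> length w = n} = (\<Union>m\<in>{1..n}. (#) 0 ` completions [0] (m - 1) (n - m))" (is "?L = ?R")
proof (intro set_eqI iffI)
  fix w assume w: "w \<in> ?L"
  then obtain v where v: "w = 0 # v"
    by (cases w) (auto simp: avoider_def weak_ascent_seq_def)
  have "count_list v 0 \<le> length v"
    by (rule count_le_length)
  then show "w \<in> ?R"
    using w v by (intro UN_I[of "Suc (count_list v 0)"]) (auto simp: completions_def)
next
  fix w assume "w \<in> ?R"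
  then show "w \<in> ?L"
    by (auto simp: completions_def)
qed

theorem theorem2p12:
  fixes n :: nat
  assumes "n \<ge> 1"
  shows "num_avoiding [0, 1, 1] n = (\<Sum>m = 1..n. (n - 1 + (m choose 2)) choose (n - m))"
proof -
  have comp: "finite (completions [0] (m - 1) (n - m))"
    "card (completions [0] (m - 1) (n - m)) = (n - 1 + (m choose 2)) choose (n - m)"
    if "m \<in> {1..n}" for m
  proof -
    have "completion_gf [0] (m - 1) = fromzero m 0"
      using that by (simp add: completion_gf_def avail_single)
    then have "finite (completions [0] (m - 1) (n - m)) \<and>
        rat_of_nat (card (completions [0] (m - 1) (n - m))) = of_nat ((n - 1 + (m choose 2)) choose (n - m))"
      using card_completions[of "[0]" "m - 1" "n - m"] fps_nth_fromzero[of m "n - m"] that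
      by (simp add: avoider_single)
    then show "finite (completions [0] (m - 1) (n - m))"
      "card (completions [0] (m - 1) (n - m)) = (n - 1 + (m choose 2)) choose (n - m)"
      by (simp_all only: of_nat_eq_iff)
  qed
  have "num_avoiding [0, 1, 1] n = card {w. avoider w \<and> length w = n}"
    unfolding num_avoiding_def avoider_def by (rule arg_cong[where f = card]) auto
  also have "\<dots> = (\<Sum>m = 1..n. card ((#) 0 ` completions [0] (m - 1) (n - m)))"
    unfolding avoider_eq_completions[OF assms] using comp(1)
    by (intro card_UN_disjoint) (auto simp: completions_def)
  also have "\<dots> = (\<Sum>m = 1..n. (n - 1 + (m choose 2)) choose (n - m))"
  proof (rule sum.cong)
    fix m assume "m \<in> {1..n}"
    then show "card ((#) 0 ` completions [0] (m - 1) (n - m)) = (n - 1 + (m choose 2)) choose (n - m)"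
      using comp(2)[of m] by (simp add: card_image)
  qed simp
  finally show ?thesis .
qed

end
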